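(* Let $R$ be a super commutative ring, and $I,J$ arbitrary sets. Let $F$ be a free supermodule over $R$ of type $(I,J)$, and let $\mathcal{B}=\{f_i^0,f_j^1\mid i\in I,j\in J\}$ be a basis of $F$. Let $M$ be a supermodule over $R$, and $\phi:\mathcal{B}\to M$ a set map. Then there exists a unique $R$-linear morphism $\widetilde\phi:F\to M$ such that $\widetilde\phi\circ i=\phi$, where $i:\mathcal{B}\hookrightarrow F$ is the inclusion.
   Context: A superring is a ring $R$ with identity together with additive subgroups $R_0,R_1$ such that $R=R_0\oplus R_1$, $R_\alpha R_\beta\subset R_{\alpha+\beta}$ for $\alpha,\beta\in\mathbb{Z}_2$, and $1\in R_0$; for homogeneous $a\in R_i$ write $|a|=i$. $R$ is super commutative if $ab=(-1)^{|a||b|}ba$ for all homogeneous $a,b$. A (right) supermodule over $R$ is a right $R$-module $M=M_0\oplus M_1$ with $M_\beta R_\alpha\subset M_{\beta+\alpha}$ for all $\alpha,\beta\in\mathbb{Z}_2$. An $R$-linear morphism $\phi:M\to N$ is an additive map with $\phi(xa)=\phi(x)a$ for all $x\in M$, $a\in R$ (not necessarily homogeneous). A supermodule $F$ is free of type $(I,J)$ if there are even elements $f_i^0\in F_0$ ($i\in I$) and odd elements $f_j^1\in F_1$ ($j\in J$) which together form a basis of $F$ as a right $R$-module, so that $F\cong(\bigoplus_{i\in I}f_i^0R)\oplus(\bigoplus_{j\in J}f_j^1R)$. *)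

theory Defs
  imports "HOL-Algebra.Algebra" "HOL-Library.Z2"
begin

text \<open>
  Degrees live in the two-element field \<^typ>\<open>bit\<close>, so that the sum and the product of degrees
  are computed modulo 2.
\<close>

record 'a graded_ring = "'a ring" +
  grade :: "bit \<Rightarrow> 'a set"

text \<open>
  As with the record of modules in HOL-Algebra, the fields for multiplication and one are
  present in the following record but carry no meaning for a module.
\<close>

record ('a, 'b) supermodule = "'b graded_ring" +
  ract :: "['b, 'a] \<Rightarrow> 'b" (infixl \<open>\<star>\<index>\<close> 70)

locale z2_graded_group = abelian_group G
  for G :: "('a, 'm) graded_ring_scheme" (structure) +
  assumes grade_subgroup: "additive_subgroup (grade G i) G"
    and grade_sum: "grade G 0 <+>\<^bsub>G\<^esub> grade G 1 = carrier G"
    and grade_Int: "grade G 0 \<inter> grade G 1 = {\<zero>\<^bsub>G\<^esub>}"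

locale superring = ring R + z2_graded_group R
  for R :: "('a, 'r) graded_ring_scheme" (structure) +
  assumes grade_mult: "\<lbrakk>a \<in> grade R i; b \<in> grade R j\<rbrakk> \<Longrightarrow> a \<otimes> b \<in> grade R (i + j)"
    and grade_one: "\<one> \<in> grade R 0"

locale supercommutative_ring = superring +
  assumes supercommutative:
    "\<lbrakk>a \<in> grade R i; b \<in> grade R j\<rbrakk> \<Longrightarrow>
      a \<otimes> b = ((\<ominus> \<one>) [^] (of_bit (i * j) :: nat)) \<otimes> (b \<otimes> a)"

locale right_module = R?: ring R + M?: abelian_group M
  for R :: "('a, 'r) ring_scheme" (structure) and M :: "('a, 'b, 'm) supermodule_scheme" (structure) +
  assumes ract_closed: "\<lbrakk>x \<in> carrier M; a \<in> carrier R\<rbrakk> \<Longrightarrow> x \<star>\<^bsub>M\<^esub> a \<in> carrier M"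
    and ract_add_left: "\<lbrakk>x \<in> carrier M; y \<in> carrier M; a \<in> carrier R\<rbrakk> \<Longrightarrow>
      (x \<oplus>\<^bsub>M\<^esub> y) \<star>\<^bsub>M\<^esub> a = x \<star>\<^bsub>M\<^esub> a \<oplus>\<^bsub>M\<^esub> y \<star>\<^bsub>M\<^esub> a"
    and ract_add_right: "\<lbrakk>x \<in> carrier M; a \<in> carrier R; b \<in> carrier R\<rbrakk> \<Longrightarrow>
      x \<star>\<^bsub>M\<^esub> (a \<oplus>\<^bsub>R\<^esub> b) = x \<star>\<^bsub>M\<^esub> a \<oplus>\<^bsub>M\<^esub> x \<star>\<^bsub>M\<^esub> b"
    and ract_assoc: "\<lbrakk>x \<in> carrier M; a \<in> carrier R; b \<in> carrier R\<rbrakk> \<Longrightarrow>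
      x \<star>\<^bsub>M\<^esub> (a \<otimes>\<^bsub>R\<^esub> b) = (x \<star>\<^bsub>M\<^esub> a) \<star>\<^bsub>M\<^esub> b"
    and ract_one: "x \<in> carrier M \<Longrightarrow> x \<star>\<^bsub>M\<^esub> \<one>\<^bsub>R\<^esub> = x"

locale supermodule = superring R + right_module R M + z2_graded_group M
  for R :: "('a, 'r) graded_ring_scheme" (structure) and M :: "('a, 'b, 'm) supermodule_scheme" (structure) +
  assumes grade_ract: "\<lbrakk>x \<in> grade M j; a \<in> grade R i\<rbrakk> \<Longrightarrow> x \<star>\<^bsub>M\<^esub> a \<in> grade M (j + i)"

text \<open>
  Morphisms need not respect the grading.  They are taken to be extensional functions, i.e.
  \<^term>\<open>undefined\<close> outside the carrier, so that equality of morphisms is equality of functions.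
\<close>

definition linear_morphisms ::
  "('a, 'r) ring_scheme \<Rightarrow> ('a, 'b, 'm) supermodule_scheme \<Rightarrow> ('a, 'c, 'n) supermodule_scheme
    \<Rightarrow> ('b \<Rightarrow> 'c) set" where
  "linear_morphisms R M N = {h \<in> carrier M \<rightarrow>\<^sub>E carrier N.
     (\<forall>x \<in> carrier M. \<forall>y \<in> carrier M. h (x \<oplus>\<^bsub>M\<^esub> y) = h x \<oplus>\<^bsub>N\<^esub> h y) \<and>
     (\<forall>x \<in> carrier M. \<forall>a \<in> carrier R. h (x \<star>\<^bsub>M\<^esub> a) = h x \<star>\<^bsub>N\<^esub> a)}"

definition right_basis ::
  "('a, 'r) ring_scheme \<Rightarrow> ('a, 'b, 'm) supermodule_scheme \<Rightarrow> 'k set \<Rightarrow> ('k \<Rightarrow> 'b) \<Rightarrow> bool" where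
  "right_basis R M K b \<longleftrightarrow>
     b \<in> K \<rightarrow> carrier M \<and>
     (\<forall>x \<in> carrier M. \<exists>S c. finite S \<and> S \<subseteq> K \<and> c \<in> S \<rightarrow> carrier R \<and>
        x = (\<Oplus>\<^bsub>M\<^esub>k\<in>S. b k \<star>\<^bsub>M\<^esub> c k)) \<and>
     (\<forall>S c. finite S \<and> S \<subseteq> K \<and> c \<in> S \<rightarrow> carrier R \<and>
        (\<Oplus>\<^bsub>M\<^esub>k\<in>S. b k \<star>\<^bsub>M\<^esub> c k) = \<zero>\<^bsub>M\<^esub> \<longrightarrow> (\<forall>k\<in>S. c k = \<zero>\<^bsub>R\<^esub>))"

text \<open>
  The even and the odd part of a homogeneous basis are combined into one family, indexed by the
  disjoint sum of the two index sets.
\<close>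

definition homogeneous_basis ::
  "('a, 'r) ring_scheme \<Rightarrow> ('a, 'b, 'm) supermodule_scheme \<Rightarrow> 'i set \<Rightarrow> 'j set
    \<Rightarrow> ('i \<Rightarrow> 'b) \<Rightarrow> ('j \<Rightarrow> 'b) \<Rightarrow> bool" where
  "homogeneous_basis R F I J f0 f1 \<longleftrightarrow>
     (\<forall>i\<in>I. f0 i \<in> grade F 0) \<and> (\<forall>j\<in>J. f1 j \<in> grade F 1) \<and>
     right_basis R F (Sum_Type.Plus I J) (case_sum f0 f1)"

definition free_supermodule ::
  "('a, 'r) graded_ring_scheme \<Rightarrow> ('a, 'b, 'm) supermodule_scheme \<Rightarrow> 'i set \<Rightarrow> 'j set \<Rightarrow> bool" where
  "free_supermodule R F I J \<longleftrightarrow> supermodule R F \<and> (\<exists>f0 f1. homogeneous_basis R F I J f0 f1)"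

end

theory Submission
  imports Defs
begin

text \<open>
  A basis \<open>b\<close> of \<open>F\<close> together with a family \<open>v\<close> in \<open>M\<close>, indexed by the same set, spans a
  submodule of \<open>F \<times> M\<close>: the one generated by the pairs \<open>(b k, v k)\<close>.  A linear map sending each
  \<open>b k\<close> to \<open>v k\<close> has to contain this submodule in its graph, so the theorem says that the
  submodule is itself the graph of a function on \<open>F\<close>.  It is total because \<open>b\<close> generates \<open>F\<close>
  (\<open>basis_span_total\<close>).  It is single-valued because, being closed under differences, it could
  only fail to be so by containing some \<open>(0, y)\<close> with \<open>y\<close> nonzero; but a linear combination of
  basis elements that equals zero has zero coefficients, and then \<open>y\<close> is zero as well
  (\<open>basis_span_functional\<close>).  Being a submodule, it is the graph of a linear map.

  The even and the odd basis elements enter as a single family indexed by the disjoint sum of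
  \<open>I\<close> and \<open>J\<close>.  Pulling the given map on the set of basis elements back to this index set
  gives the family \<open>v\<close>, and repetitions in \<open>b\<close>, which occur over the zero ring, do no harm.
\<close>

section \<open>Linear combinations in a right module\<close>

definition lincomb ::
  "('a, 'b, 'm) supermodule_scheme \<Rightarrow> ('k \<Rightarrow> 'b) \<Rightarrow> 'k set \<Rightarrow> ('k \<Rightarrow> 'a) \<Rightarrow> 'b" where
  "lincomb M b S c = (\<Oplus>\<^bsub>M\<^esub>k\<in>S. b k \<star>\<^bsub>M\<^esub> c k)"

context right_module
begin

lemma ract_zero_right:
  assumes "x \<in> carrier M" shows "x \<star>\<^bsub>M\<^esub> \<zero>\<^bsub>R\<^esub> = \<zero>\<^bsub>M\<^esub>"
proof -
  have c: "x \<star>\<^bsub>M\<^esub> \<zero>\<^bsub>R\<^esub> \<in> carrier M" using assms by (simp add: ract_closed)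
  have "x \<star>\<^bsub>M\<^esub> \<zero>\<^bsub>R\<^esub> \<oplus>\<^bsub>M\<^esub> x \<star>\<^bsub>M\<^esub> \<zero>\<^bsub>R\<^esub> = x \<star>\<^bsub>M\<^esub> \<zero>\<^bsub>R\<^esub>"
    using ract_add_right[OF assms R.zero_closed R.zero_closed] by simp
  then show ?thesis using c M.add.l_cancel_one' by metis
qed

lemma ract_zero_left:
  assumes "a \<in> carrier R" shows "\<zero>\<^bsub>M\<^esub> \<star>\<^bsub>M\<^esub> a = \<zero>\<^bsub>M\<^esub>"
proof -
  have c: "\<zero>\<^bsub>M\<^esub> \<star>\<^bsub>M\<^esub> a \<in> carrier M" using assms by (simp add: ract_closed)
  have "\<zero>\<^bsub>M\<^esub> \<star>\<^bsub>M\<^esub> a \<oplus>\<^bsub>M\<^esub> \<zero>\<^bsub>M\<^esub> \<star>\<^bsub>M\<^esub> a = \<zero>\<^bsub>M\<^esub> \<star>\<^bsub>M\<^esub> a"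
    using ract_add_left[OF M.zero_closed M.zero_closed assms] by simp
  then show ?thesis using c M.add.l_cancel_one' by metis
qed

lemma ract_minus_one:
  assumes "x \<in> carrier M" shows "x \<star>\<^bsub>M\<^esub> (\<ominus>\<^bsub>R\<^esub> \<one>\<^bsub>R\<^esub>) = \<ominus>\<^bsub>M\<^esub> x"
proof -
  have "x \<star>\<^bsub>M\<^esub> (\<ominus>\<^bsub>R\<^esub> \<one>\<^bsub>R\<^esub>) \<oplus>\<^bsub>M\<^esub> x = x \<star>\<^bsub>M\<^esub> (\<ominus>\<^bsub>R\<^esub> \<one>\<^bsub>R\<^esub> \<oplus>\<^bsub>R\<^esub> \<one>\<^bsub>R\<^esub>)"
    using assms by (simp add: ract_add_right ract_one)
  also have "\<dots> = \<zero>\<^bsub>M\<^esub>" using assms by (simp add: R.l_neg ract_zero_right)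
  finally show ?thesis using assms M.minus_equality by (simp add: ract_closed)
qed

lemma lincomb_closed:
  assumes "b \<in> S \<rightarrow> carrier M" "c \<in> S \<rightarrow> carrier R"
  shows "lincomb M b S c \<in> carrier M"
  unfolding lincomb_def using assms by (intro M.finsum_closed) (auto simp: Pi_iff ract_closed)

text \<open>
  Extending the coefficients by zero brings two linear combinations to a common index set.
\<close>

lemma lincomb_extend:
  assumes "finite T" "S \<subseteq> T" "b \<in> T \<rightarrow> carrier M" "c \<in> S \<rightarrow> carrier R"
  shows "lincomb M b T (\<lambda>k. if k \<in> S then c k else \<zero>\<^bsub>R\<^esub>) = lincomb M b S c"
  unfolding lincomb_def using assms
  by (intro M.add.finprod_mono_neutral_cong_right)
     (auto simp: Pi_iff ract_closed ract_zero_right)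

lemma lincomb_add:
  assumes "b \<in> S \<rightarrow> carrier M" "c \<in> S \<rightarrow> carrier R" "d \<in> S \<rightarrow> carrier R"
  shows "lincomb M b S (\<lambda>k. c k \<oplus>\<^bsub>R\<^esub> d k) = lincomb M b S c \<oplus>\<^bsub>M\<^esub> lincomb M b S d"
proof -
  have "lincomb M b S (\<lambda>k. c k \<oplus>\<^bsub>R\<^esub> d k) = (\<Oplus>\<^bsub>M\<^esub>k\<in>S. b k \<star>\<^bsub>M\<^esub> c k \<oplus>\<^bsub>M\<^esub> b k \<star>\<^bsub>M\<^esub> d k)"
    unfolding lincomb_def using assms
    by (intro M.finsum_cong') (auto simp: Pi_iff ract_closed ract_add_right)
  also have "\<dots> = lincomb M b S c \<oplus>\<^bsub>M\<^esub> lincomb M b S d"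
    unfolding lincomb_def using assms
    by (intro M.finsum_addf) (auto simp: Pi_iff ract_closed)
  finally show ?thesis .
qed

lemma lincomb_insert:
  assumes "finite S" "k \<notin> S" "b \<in> insert k S \<rightarrow> carrier M" "c \<in> insert k S \<rightarrow> carrier R"
  shows "lincomb M b (insert k S) c = b k \<star>\<^bsub>M\<^esub> c k \<oplus>\<^bsub>M\<^esub> lincomb M b S c"
  unfolding lincomb_def using assms by (intro M.finsum_insert) (auto simp: Pi_iff ract_closed)

lemma lincomb_empty: "lincomb M b {} c = \<zero>\<^bsub>M\<^esub>"
  by (simp add: lincomb_def)

lemma lincomb_single:
  assumes "b k \<in> carrier M"
  shows "lincomb M b {k} (\<lambda>_. \<one>\<^bsub>R\<^esub>) = b k"
  using assms lincomb_insert[of "{}" k b "\<lambda>_. \<one>\<^bsub>R\<^esub>"] by (simp add: lincomb_empty ract_one)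

lemma lincomb_ract:
  assumes "finite S" "b \<in> S \<rightarrow> carrier M" "c \<in> S \<rightarrow> carrier R" "a \<in> carrier R"
  shows "lincomb M b S (\<lambda>k. c k \<otimes>\<^bsub>R\<^esub> a) = lincomb M b S c \<star>\<^bsub>M\<^esub> a"
  using assms
proof (induction S)
  case empty
  then show ?case by (simp add: lincomb_empty ract_zero_left)
next
  case (insert k S)
  have b: "b \<in> S \<rightarrow> carrier M" "b k \<in> carrier M" and c: "c \<in> S \<rightarrow> carrier R" "c k \<in> carrier R"
    using insert.prems by auto
  have "lincomb M b (insert k S) (\<lambda>k. c k \<otimes>\<^bsub>R\<^esub> a)
      = b k \<star>\<^bsub>M\<^esub> (c k \<otimes>\<^bsub>R\<^esub> a) \<oplus>\<^bsub>M\<^esub> lincomb M b S (\<lambda>k. c k \<otimes>\<^bsub>R\<^esub> a)"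
    using insert by (intro lincomb_insert) auto
  also have "\<dots> = (b k \<star>\<^bsub>M\<^esub> c k) \<star>\<^bsub>M\<^esub> a \<oplus>\<^bsub>M\<^esub> lincomb M b S c \<star>\<^bsub>M\<^esub> a"
    using insert.IH[OF b(1) c(1)] insert.prems b c by (simp add: ract_assoc)
  also have "\<dots> = (b k \<star>\<^bsub>M\<^esub> c k \<oplus>\<^bsub>M\<^esub> lincomb M b S c) \<star>\<^bsub>M\<^esub> a"
    using insert.prems b c by (simp add: ract_add_left ract_closed lincomb_closed)
  also have "\<dots> = lincomb M b (insert k S) c \<star>\<^bsub>M\<^esub> a"
    using insert by (simp add: lincomb_insert)
  finally show ?case .
qed

end

lemma right_basis_iff_lincomb:
  "right_basis R M K b \<longleftrightarrow>
     b \<in> K \<rightarrow> carrier M \<and>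
     (\<forall>x \<in> carrier M. \<exists>S c. finite S \<and> S \<subseteq> K \<and> c \<in> S \<rightarrow> carrier R \<and> x = lincomb M b S c) \<and>
     (\<forall>S c. finite S \<and> S \<subseteq> K \<and> c \<in> S \<rightarrow> carrier R \<and> lincomb M b S c = \<zero>\<^bsub>M\<^esub>
        \<longrightarrow> (\<forall>k\<in>S. c k = \<zero>\<^bsub>R\<^esub>))"
  by (simp only: right_basis_def lincomb_def)

section \<open>The span of a family of pairs\<close>

definition pair_span ::
  "('a, 'r) ring_scheme \<Rightarrow> ('a, 'b, 'm) supermodule_scheme \<Rightarrow> ('a, 'c, 'n) supermodule_scheme
    \<Rightarrow> 'k set \<Rightarrow> ('k \<Rightarrow> 'b) \<Rightarrow> ('k \<Rightarrow> 'c) \<Rightarrow> ('b \<times> 'c) set" where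
  "pair_span R F M K b v =
     {(lincomb F b S c, lincomb M v S c) | S c. finite S \<and> S \<subseteq> K \<and> c \<in> S \<rightarrow> carrier R}"

lemma pair_spanI:
  "\<lbrakk>finite S; S \<subseteq> K; c \<in> S \<rightarrow> carrier R; x = lincomb F b S c; y = lincomb M v S c\<rbrakk>
    \<Longrightarrow> (x, y) \<in> pair_span R F M K b v"
  unfolding pair_span_def by auto

lemma pair_spanE:
  assumes "(x, y) \<in> pair_span R F M K b v"
  obtains S c where "finite S" "S \<subseteq> K" "c \<in> S \<rightarrow> carrier R"
    "x = lincomb F b S c" "y = lincomb M v S c"
  using assms unfolding pair_span_def by auto

locale module_families = F: right_module R F + M: right_module R M
  for R :: "('a, 'r) ring_scheme"
    and F :: "('a, 'b, 'm) supermodule_scheme"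
    and M :: "('a, 'c, 'n) supermodule_scheme" +
  fixes K :: "'k set" and b :: "'k \<Rightarrow> 'b" and v :: "'k \<Rightarrow> 'c"
  assumes b_closed: "b \<in> K \<rightarrow> carrier F" and v_closed: "v \<in> K \<rightarrow> carrier M"
begin

abbreviation span_rel :: "('b \<times> 'c) set" where
  "span_rel \<equiv> pair_span R F M K b v"

lemma families_closed:
  assumes "S \<subseteq> K" shows "b \<in> S \<rightarrow> carrier F" "v \<in> S \<rightarrow> carrier M"
  using assms b_closed v_closed by auto

lemma span_closed:
  assumes "(x, y) \<in> span_rel" shows "x \<in> carrier F" "y \<in> carrier M"
proof -
  from assms obtain S c where S: "finite S" "S \<subseteq> K" "c \<in> S \<rightarrow> carrier R"
    "x = lincomb F b S c" "y = lincomb M v S c" by (rule pair_spanE)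
  show "x \<in> carrier F" "y \<in> carrier M"
    unfolding S(4,5) using families_closed[OF S(2)] S(3)
    by (simp_all add: F.lincomb_closed M.lincomb_closed)
qed

lemma span_add:
  assumes "(x, y) \<in> span_rel" "(x', y') \<in> span_rel"
  shows "(x \<oplus>\<^bsub>F\<^esub> x', y \<oplus>\<^bsub>M\<^esub> y') \<in> span_rel"
proof -
  from assms(1) obtain S c where S: "finite S" "S \<subseteq> K" "c \<in> S \<rightarrow> carrier R"
    "x = lincomb F b S c" "y = lincomb M v S c" by (rule pair_spanE)
  from assms(2) obtain T d where T: "finite T" "T \<subseteq> K" "d \<in> T \<rightarrow> carrier R"
    "x' = lincomb F b T d" "y' = lincomb M v T d" by (rule pair_spanE)
  define c' where "c' k = (if k \<in> S then c k else \<zero>\<^bsub>R\<^esub>)" for k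
  define d' where "d' k = (if k \<in> T then d k else \<zero>\<^bsub>R\<^esub>)" for k
  have U: "finite (S \<union> T)" "S \<union> T \<subseteq> K" using S T by auto
  note bv = families_closed[OF U(2)]
  have coeff: "c' \<in> S \<union> T \<rightarrow> carrier R" "d' \<in> S \<union> T \<rightarrow> carrier R"
    using S(3) T(3) by (auto simp: c'_def d'_def)
  have x: "x = lincomb F b (S \<union> T) c'" "x' = lincomb F b (S \<union> T) d'"
    unfolding c'_def d'_def S(4) T(4)
    using U bv S(3) T(3) by (auto intro!: F.lincomb_extend[symmetric])
  have y: "y = lincomb M v (S \<union> T) c'" "y' = lincomb M v (S \<union> T) d'"
    unfolding c'_def d'_def S(5) T(5)
    using U bv S(3) T(3) by (auto intro!: M.lincomb_extend[symmetric])
  show ?thesis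
  proof (rule pair_spanI)
    show "finite (S \<union> T)" "S \<union> T \<subseteq> K" by (fact U)+
    show "(\<lambda>k. c' k \<oplus>\<^bsub>R\<^esub> d' k) \<in> S \<union> T \<rightarrow> carrier R" using coeff by (auto simp: Pi_iff)
    show "x \<oplus>\<^bsub>F\<^esub> x' = lincomb F b (S \<union> T) (\<lambda>k. c' k \<oplus>\<^bsub>R\<^esub> d' k)"
      unfolding x using bv coeff by (simp add: F.lincomb_add)
    show "y \<oplus>\<^bsub>M\<^esub> y' = lincomb M v (S \<union> T) (\<lambda>k. c' k \<oplus>\<^bsub>R\<^esub> d' k)"
      unfolding y using bv coeff by (simp add: M.lincomb_add)
  qed
qed

lemma span_ract:
  assumes "(x, y) \<in> span_rel" "a \<in> carrier R"
  shows "(x \<star>\<^bsub>F\<^esub> a, y \<star>\<^bsub>M\<^esub> a) \<in> span_rel"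
proof -
  from assms(1) obtain S c where S: "finite S" "S \<subseteq> K" "c \<in> S \<rightarrow> carrier R"
    "x = lincomb F b S c" "y = lincomb M v S c" by (rule pair_spanE)
  note bv = families_closed[OF S(2)]
  show ?thesis
  proof (rule pair_spanI)
    show "finite S" "S \<subseteq> K" by (fact S)+
    show "(\<lambda>k. c k \<otimes>\<^bsub>R\<^esub> a) \<in> S \<rightarrow> carrier R" using S(3) assms(2) by (auto simp: Pi_iff)
    show "x \<star>\<^bsub>F\<^esub> a = lincomb F b S (\<lambda>k. c k \<otimes>\<^bsub>R\<^esub> a)"
      unfolding S(4) using S bv assms(2) by (simp add: F.lincomb_ract)
    show "y \<star>\<^bsub>M\<^esub> a = lincomb M v S (\<lambda>k. c k \<otimes>\<^bsub>R\<^esub> a)"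
      unfolding S(5) using S bv assms(2) by (simp add: M.lincomb_ract)
  qed
qed

lemma generator_in_span:
  assumes "k \<in> K" shows "(b k, v k) \<in> span_rel"
proof (rule pair_spanI[where S = "{k}" and c = "\<lambda>_. \<one>\<^bsub>R\<^esub>"])
  show "b k = lincomb F b {k} (\<lambda>_. \<one>\<^bsub>R\<^esub>)" "v k = lincomb M v {k} (\<lambda>_. \<one>\<^bsub>R\<^esub>)"
    using assms b_closed v_closed by (auto simp: F.lincomb_single M.lincomb_single Pi_iff)
qed (use assms in auto)

text \<open>
  Every linear map with the prescribed values contains the span in its graph, since the span is
  generated by the pairs \<open>(b k, v k)\<close>.
\<close>

lemma linear_morphism_respects_span:
  assumes h: "h \<in> linear_morphisms R F M" and hb: "\<And>k. k \<in> K \<Longrightarrow> h (b k) = v k"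
    and "(x, y) \<in> span_rel"
  shows "h x = y"
proof -
  have h_closed: "\<And>x. x \<in> carrier F \<Longrightarrow> h x \<in> carrier M"
    and h_add: "\<And>x y. \<lbrakk>x \<in> carrier F; y \<in> carrier F\<rbrakk> \<Longrightarrow> h (x \<oplus>\<^bsub>F\<^esub> y) = h x \<oplus>\<^bsub>M\<^esub> h y"
    and h_ract: "\<And>x a. \<lbrakk>x \<in> carrier F; a \<in> carrier R\<rbrakk> \<Longrightarrow> h (x \<star>\<^bsub>F\<^esub> a) = h x \<star>\<^bsub>M\<^esub> a"
    using h by (auto simp: linear_morphisms_def)
  from assms(3) obtain S c where S: "finite S" "S \<subseteq> K" "c \<in> S \<rightarrow> carrier R"
    "x = lincomb F b S c" "y = lincomb M v S c" by (rule pair_spanE)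
  have "h (lincomb F b S c) = lincomb M v S c"
    using S(1-3)
  proof (induction S)
    case empty
    have "h \<zero>\<^bsub>F\<^esub> = h (\<zero>\<^bsub>F\<^esub> \<star>\<^bsub>F\<^esub> \<zero>\<^bsub>R\<^esub>)" by (simp add: F.ract_zero_left)
    also have "\<dots> = \<zero>\<^bsub>M\<^esub>" by (simp add: h_ract h_closed M.ract_zero_right)
    finally show ?case by (simp add: F.lincomb_empty M.lincomb_empty)
  next
    case (insert k S)
    note bv = families_closed[OF insert.prems(1)]
    have "h (lincomb F b (insert k S) c) = h (b k \<star>\<^bsub>F\<^esub> c k \<oplus>\<^bsub>F\<^esub> lincomb F b S c)"
      using insert bv by (simp add: F.lincomb_insert)
    also have "\<dots> = h (b k) \<star>\<^bsub>M\<^esub> c k \<oplus>\<^bsub>M\<^esub> h (lincomb F b S c)"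
      using insert.prems bv by (simp add: h_add h_ract F.ract_closed F.lincomb_closed Pi_iff)
    also have "\<dots> = v k \<star>\<^bsub>M\<^esub> c k \<oplus>\<^bsub>M\<^esub> lincomb M v S c"
      using insert hb by simp
    also have "\<dots> = lincomb M v (insert k S) c"
      using insert bv by (simp add: M.lincomb_insert)
    finally show ?case .
  qed
  then show ?thesis using S(4,5) by simp
qed

section \<open>The universal property of a basis\<close>

lemma basis_span_total:
  assumes "right_basis R F K b" "x \<in> carrier F"
  shows "\<exists>y. (x, y) \<in> span_rel"
proof -
  obtain S c where "finite S" "S \<subseteq> K" "c \<in> S \<rightarrow> carrier R" "x = lincomb F b S c"
    using assms unfolding right_basis_iff_lincomb by metis
  then have "(x, lincomb M v S c) \<in> span_rel" by (intro pair_spanI) auto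
  then show ?thesis ..
qed

text \<open>
  The difference of two values at the same point is a value at zero, hence a linear combination of
  the \<open>v k\<close> with zero coefficients.
\<close>

lemma basis_span_functional:
  assumes basis: "right_basis R F K b" and y: "(x, y) \<in> span_rel" and y': "(x, y') \<in> span_rel"
  shows "y = y'"
proof -
  note closed = span_closed[OF y] span_closed[OF y']
  have "(x \<oplus>\<^bsub>F\<^esub> x \<star>\<^bsub>F\<^esub> (\<ominus>\<^bsub>R\<^esub> \<one>\<^bsub>R\<^esub>), y \<oplus>\<^bsub>M\<^esub> y' \<star>\<^bsub>M\<^esub> (\<ominus>\<^bsub>R\<^esub> \<one>\<^bsub>R\<^esub>)) \<in> span_rel"
    using y y' by (intro span_add span_ract) auto
  then have "(\<zero>\<^bsub>F\<^esub>, y \<oplus>\<^bsub>M\<^esub> \<ominus>\<^bsub>M\<^esub> y') \<in> span_rel"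
    using closed by (simp add: F.ract_minus_one M.ract_minus_one F.M.r_neg)
  then obtain S c where S: "finite S" "S \<subseteq> K" "c \<in> S \<rightarrow> carrier R"
    "\<zero>\<^bsub>F\<^esub> = lincomb F b S c" "y \<oplus>\<^bsub>M\<^esub> \<ominus>\<^bsub>M\<^esub> y' = lincomb M v S c" by (rule pair_spanE)
  have "\<forall>k\<in>S. c k = \<zero>\<^bsub>R\<^esub>"
    using basis S(1-4) unfolding right_basis_iff_lincomb by metis
  then have "lincomb M v S c = \<zero>\<^bsub>M\<^esub>"
    unfolding lincomb_def using families_closed[OF S(2)]
    by (intro M.M.add.finprod_one_eqI) (auto simp: M.ract_zero_right Pi_iff)
  then have "\<ominus>\<^bsub>M\<^esub> (\<ominus>\<^bsub>M\<^esub> y') = y"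
    using S(5) closed by (intro M.M.minus_equality) auto
  then show ?thesis using closed by (simp add: M.M.minus_minus)
qed

theorem basis_universal_property:
  assumes basis: "right_basis R F K b"
  shows "\<exists>!h. h \<in> linear_morphisms R F M \<and> (\<forall>k\<in>K. h (b k) = v k)"
proof -
  define h where "h = (\<lambda>x\<in>carrier F. THE y. (x, y) \<in> span_rel)"
  have h_eqI: "h x = y" if "(x, y) \<in> span_rel" for x y
    unfolding h_def using that span_closed[OF that] basis_span_functional[OF basis]
    by (auto intro: the_equality)
  have h_span: "(x, h x) \<in> span_rel" if "x \<in> carrier F" for x
    using basis_span_total[OF basis that] h_eqI by auto
  have h_linear: "h \<in> linear_morphisms R F M"
    unfolding linear_morphisms_def
  proof (intro CollectI conjI ballI)
    show "h \<in> carrier F \<rightarrow>\<^sub>E carrier M"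
      using span_closed(2)[OF h_span] by (auto simp: h_def)
    show "h (x \<oplus>\<^bsub>F\<^esub> y) = h x \<oplus>\<^bsub>M\<^esub> h y" if "x \<in> carrier F" "y \<in> carrier F" for x y
      using that by (intro h_eqI span_add h_span)
    show "h (x \<star>\<^bsub>F\<^esub> a) = h x \<star>\<^bsub>M\<^esub> a" if "x \<in> carrier F" "a \<in> carrier R" for x a
      using that by (intro h_eqI span_ract h_span)
  qed
  moreover have h_basis: "\<forall>k\<in>K. h (b k) = v k"
    using generator_in_span h_eqI by blast
  moreover have "g = h" if g: "g \<in> linear_morphisms R F M" "\<forall>k\<in>K. g (b k) = v k" for g
  proof (rule extensionalityI[where A = "carrier F"])
    show "g \<in> extensional (carrier F)" "h \<in> extensional (carrier F)"
      using g(1) h_linear by (auto simp: linear_morphisms_def PiE_def)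
    show "g x = h x" if "x \<in> carrier F" for x
      using linear_morphism_respects_span[OF g(1) _ h_span[OF that]] g(2) by simp
  qed
  ultimately show ?thesis by blast
qed

end

theorem theorem2p7:
  fixes R :: "('a, 'r) graded_ring_scheme"
    and F :: "('a, 'b, 'm) supermodule_scheme"
    and M :: "('a, 'c, 'n) supermodule_scheme"
    and I :: "'i set" and J :: "'j set"
    and f0 :: "'i \<Rightarrow> 'b" and f1 :: "'j \<Rightarrow> 'b"
    and B :: "'b set" and \<phi> :: "'b \<Rightarrow> 'c"
  assumes "supercommutative_ring R"
    and "free_supermodule R F I J"
    and "homogeneous_basis R F I J f0 f1"
    and "B = f0 ` I \<union> f1 ` J"
    and "supermodule R M"
    and "\<phi> \<in> B \<rightarrow> carrier M"
  shows "\<exists>!h. h \<in> linear_morphisms R F M \<and> (\<forall>b\<in>B. h b = \<phi> b)"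
proof -
  let ?b = "case_sum f0 f1" and ?K = "Sum_Type.Plus I J"
  have F: "right_module R F" and M: "right_module R M"
    using assms(2,5) by (auto simp: free_supermodule_def supermodule_def)
  have basis: "right_basis R F ?K ?b"
    using assms(3) by (simp add: homogeneous_basis_def)
  have B: "B = ?b ` ?K"
    unfolding assms(4) Plus_def by (simp add: image_Un image_image)
  have "module_families R F M ?K ?b (\<phi> \<circ> ?b)"
  proof (intro module_families.intro module_families_axioms.intro F M)
    show "?b \<in> ?K \<rightarrow> carrier F" using basis by (simp add: right_basis_def)
    show "\<phi> \<circ> ?b \<in> ?K \<rightarrow> carrier M" unfolding comp_def by (intro Pi_I funcset_mem[OF assms(6)]) (simp add: B)
  qed
  from module_families.basis_universal_property[OF this basis]
  show ?thesis unfolding B by simp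
qed

end
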